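(* For any integer $n>4$ the set $\mathcal{MAX}(\mathcal{E}_{\lozenge_n})$ is a maximal ideal of the semiring $\mathcal{E}_{\lozenge_n}$.
   Context: A semiring is a set with a commutative associative addition and an associative multiplication satisfying both distributive laws (no zero or identity is required). An ideal $I$ of $R$ is a nonempty subset closed under addition with $RI\subseteq I$ and $IR\subseteq I$; it is maximal if $I\ne R$ and no ideal $J$ satisfies $I\subsetneq J\subsetneq R$. For $n\ge 4$, $\lozenge_n$ is the lattice with $n$ elements $0,1,a_1,\dots,a_{n-2}$, where $0$ is the least element, $1$ is the greatest element and $a_1,\dots,a_{n-2}$ are pairwise incomparable (so $a_i\vee a_j=1$ for $i\ne j$). $\mathcal{E}_{\lozenge_n}$ is the semiring of all maps $\alpha:\lozenge_n\to\lozenge_n$ with $\alpha(x\vee y)=\alpha(x)\vee\alpha(y)$ and $\alpha(0)=0$, with operations $(\alpha+\beta)(x)=\alpha(x)\vee\beta(x)$ and $(\alpha\cdot\beta)(x)=\beta(\alpha(x))$. $\mathcal{P}(\mathcal{E}_{\lozenge_n})$ is the set of all $\alpha\in\mathcal{E}_{\lozenge_n}$ with $\alpha(1)=1$ that restrict to a permutation of $\{a_1,\dots,a_{n-2}\}$. $\mathcal{MAX}(\mathcal{E}_{\lozenge_n})=\mathcal{E}_{\lozenge_n}\setminus\mathcal{P}(\mathcal{E}_{\lozenge_n})$; that is, it consists of the zero map $\overline{0}$ and all $\alpha\in\mathcal{E}_{\lozenge_n}$ with $\alpha(1)=a_i$ or $\alpha(a_i)=1$ for some $i\in\{1,\dots,n-2\}$.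 *)

theory Defs
  imports Main "HOL-Library.FuncSet" "HOL-Algebra.Congruence"
begin

section \<open>Semirings without zero and identity, and their maximal ideals\<close>

record 'a semiring_struct = "'a partial_object" +
  splus :: "'a \<Rightarrow> 'a \<Rightarrow> 'a" (infixl \<open>\<oplus>\<^sub>s\<index>\<close> 65)
  stimes :: "'a \<Rightarrow> 'a \<Rightarrow> 'a" (infixl \<open>\<otimes>\<^sub>s\<index>\<close> 70)

text \<open>Neither a zero nor an identity is required, in contrast to the locale
  \<open>semiring\<close> of HOL-Algebra.\<close>

locale bare_semiring =
  fixes R (structure)
  assumes splus_closed: "\<lbrakk>x \<in> carrier R; y \<in> carrier R\<rbrakk> \<Longrightarrow> x \<oplus>\<^sub>s y \<in> carrier R"
    and stimes_closed: "\<lbrakk>x \<in> carrier R; y \<in> carrier R\<rbrakk> \<Longrightarrow> x \<otimes>\<^sub>s y \<in> carrier R"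
    and splus_assoc: "\<lbrakk>x \<in> carrier R; y \<in> carrier R; z \<in> carrier R\<rbrakk>
      \<Longrightarrow> (x \<oplus>\<^sub>s y) \<oplus>\<^sub>s z = x \<oplus>\<^sub>s (y \<oplus>\<^sub>s z)"
    and splus_commute: "\<lbrakk>x \<in> carrier R; y \<in> carrier R\<rbrakk> \<Longrightarrow> x \<oplus>\<^sub>s y = y \<oplus>\<^sub>s x"
    and stimes_assoc: "\<lbrakk>x \<in> carrier R; y \<in> carrier R; z \<in> carrier R\<rbrakk>
      \<Longrightarrow> (x \<otimes>\<^sub>s y) \<otimes>\<^sub>s z = x \<otimes>\<^sub>s (y \<otimes>\<^sub>s z)"
    and distrib_left: "\<lbrakk>x \<in> carrier R; y \<in> carrier R; z \<in> carrier R\<rbrakk>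
      \<Longrightarrow> x \<otimes>\<^sub>s (y \<oplus>\<^sub>s z) = (x \<otimes>\<^sub>s y) \<oplus>\<^sub>s (x \<otimes>\<^sub>s z)"
    and distrib_right: "\<lbrakk>x \<in> carrier R; y \<in> carrier R; z \<in> carrier R\<rbrakk>
      \<Longrightarrow> (x \<oplus>\<^sub>s y) \<otimes>\<^sub>s z = (x \<otimes>\<^sub>s z) \<oplus>\<^sub>s (y \<otimes>\<^sub>s z)"

locale semiring_ideal = bare_semiring R for I and R (structure) +
  assumes ideal_subset: "I \<subseteq> carrier R"
    and ideal_nonempty: "I \<noteq> {}"
    and ideal_splus: "\<lbrakk>x \<in> I; y \<in> I\<rbrakk> \<Longrightarrow> x \<oplus>\<^sub>s y \<in> I"
    and ideal_stimes_left: "\<lbrakk>r \<in> carrier R; x \<in> I\<rbrakk> \<Longrightarrow> r \<otimes>\<^sub>s x \<in> I"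
    and ideal_stimes_right: "\<lbrakk>x \<in> I; r \<in> carrier R\<rbrakk> \<Longrightarrow> x \<otimes>\<^sub>s r \<in> I"

locale maximal_semiring_ideal = semiring_ideal I R for I and R (structure) +
  assumes ideal_proper: "I \<noteq> carrier R"
    and ideal_maximal: "\<nexists>J. semiring_ideal J R \<and> I \<subset> J \<and> J \<subset> carrier R"


section \<open>The lattices \<open>\<diamond>\<^sub>n\<close>\<close>

text \<open>The type carries the lattice with countably many pairwise incomparable elements
  between bottom and top; \<open>\<diamond>\<^sub>n\<close> is its sublattice on the \<open>n\<close> elements
  \<open>\<bottom>, \<top>, a\<^sub>1, \<dots>, a\<^sub>n\<^sub>-\<^sub>2\<close>.\<close>

datatype diamond = Bot | Atom nat | Top

instantiation diamond :: bounded_lattice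
begin

definition bot_diamond :: diamond where "bot_diamond = Bot"
definition top_diamond :: diamond where "top_diamond = Top"

definition less_eq_diamond :: "diamond \<Rightarrow> diamond \<Rightarrow> bool" where
  "less_eq_diamond x y \<longleftrightarrow> x = Bot \<or> y = Top \<or> x = y"

definition less_diamond :: "diamond \<Rightarrow> diamond \<Rightarrow> bool" where
  "less_diamond x y \<longleftrightarrow> x \<le> y \<and> x \<noteq> y"

definition sup_diamond :: "diamond \<Rightarrow> diamond \<Rightarrow> diamond" where
  "sup_diamond x y = (if x \<le> y then y else if y \<le> x then x else Top)"

definition inf_diamond :: "diamond \<Rightarrow> diamond \<Rightarrow> diamond" where
  "inf_diamond x y = (if x \<le> y then x else if y \<le> x then y else Bot)"

instance
  by intro_classes
    (auto simp: bot_diamond_def top_diamond_def less_eq_diamond_def less_diamond_def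
      sup_diamond_def inf_diamond_def)

end

definition diamond_atoms :: "nat \<Rightarrow> diamond set" where
  "diamond_atoms n = Atom ` {1..n - 2}"

definition diamond_lattice :: "nat \<Rightarrow> diamond set" where
  "diamond_lattice n = {bot, top} \<union> diamond_atoms n"

lemma card_diamond_lattice:
  assumes "n \<ge> 2"
  shows "card (diamond_lattice n) = n"
proof -
  have "card (diamond_atoms n) = n - 2"
    by (simp add: diamond_atoms_def card_image inj_on_def)
  moreover have "finite (diamond_atoms n)" "Bot \<notin> diamond_atoms n" "Top \<notin> diamond_atoms n"
    by (auto simp: diamond_atoms_def)
  ultimately show ?thesis
    using assms by (simp add: diamond_lattice_def bot_diamond_def top_diamond_def)
qed

lemma sup_closed_diamond_lattice:
  "x \<in> diamond_lattice n \<Longrightarrow> y \<in> diamond_lattice n \<Longrightarrow> sup x y \<in> diamond_lattice n"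
  by (auto simp: sup_diamond_def diamond_lattice_def top_diamond_def)


section \<open>Endomorphism semirings\<close>

text \<open>Maps \<open>L \<rightarrow> L\<close> are represented as extensional functions, so that distinct elements of
  the carrier are distinct as maps on \<open>L\<close>.  Products are read from left to right:
  \<open>(\<alpha> \<cdot> \<beta>)(x) = \<beta> (\<alpha> x)\<close>.\<close>

definition join_endos :: "'a::bounded_semilattice_sup_bot set \<Rightarrow> ('a \<Rightarrow> 'a) set" where
  "join_endos L = {\<alpha> \<in> L \<rightarrow>\<^sub>E L.
     (\<forall>x\<in>L. \<forall>y\<in>L. \<alpha> (sup x y) = sup (\<alpha> x) (\<alpha> y)) \<and> \<alpha> bot = bot}"

definition endo_semiring ::
  "'a::bounded_semilattice_sup_bot set \<Rightarrow> ('a \<Rightarrow> 'a) semiring_struct" where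
  "endo_semiring L = \<lparr>carrier = join_endos L,
     splus = (\<lambda>\<alpha> \<beta>. \<lambda>x\<in>L. sup (\<alpha> x) (\<beta> x)),
     stimes = (\<lambda>\<alpha> \<beta>. \<lambda>x\<in>L. \<beta> (\<alpha> x))\<rparr>"

abbreviation diamond_endos :: "nat \<Rightarrow> (diamond \<Rightarrow> diamond) semiring_struct" where
  "diamond_endos n \<equiv> endo_semiring (diamond_lattice n)"

lemma bare_semiring_endo_semiring:
  assumes "bot \<in> L" and sup: "\<And>x y. x \<in> L \<Longrightarrow> y \<in> L \<Longrightarrow> sup x y \<in> L"
  shows "bare_semiring (endo_semiring L)"
proof
  fix \<alpha> \<beta> \<gamma>
  assume a: "\<alpha> \<in> carrier (endo_semiring L)" "\<beta> \<in> carrier (endo_semiring L)"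
  then have m: "\<And>x. x \<in> L \<Longrightarrow> \<alpha> x \<in> L" "\<And>x. x \<in> L \<Longrightarrow> \<beta> x \<in> L"
    by (auto simp: endo_semiring_def join_endos_def)
  show "\<alpha> \<oplus>\<^sub>s\<^bsub>endo_semiring L\<^esub> \<beta> \<in> carrier (endo_semiring L)"
    using a assms m by (auto simp: endo_semiring_def join_endos_def sup_aci)
  show "\<alpha> \<otimes>\<^sub>s\<^bsub>endo_semiring L\<^esub> \<beta> \<in> carrier (endo_semiring L)"
    using a assms m by (auto simp: endo_semiring_def join_endos_def)
qed (use sup in \<open>auto simp: endo_semiring_def join_endos_def sup_aci fun_eq_iff restrict_def PiE_iff\<close>)

definition diamond_perms :: "nat \<Rightarrow> (diamond \<Rightarrow> diamond) set" where
  "diamond_perms n = {\<alpha> \<in> carrier (diamond_endos n).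
     \<alpha> top = top \<and> bij_betw \<alpha> (diamond_atoms n) (diamond_atoms n)}"

definition diamond_MAX :: "nat \<Rightarrow> (diamond \<Rightarrow> diamond) set" where
  "diamond_MAX n = carrier (diamond_endos n) - diamond_perms n"

end

theory Submission
  imports Defs
begin

text \<open>The elements of \<open>\<P>\<close> are exactly the bijective endomorphisms. On a finite lattice a composite
  is bijective only if both factors are, so the complement of \<open>\<P>\<close> absorbs products; and since
  bijective endomorphisms are units, no larger proper ideal exists. For sums, let \<open>\<alpha>\<close> lie below a
  bijective \<open>\<pi>\<close> and differ from it. Then \<open>\<alpha>\<close> kills some atom, so \<open>\<alpha>(1) = \<alpha>(a\<^sub>j)\<close> lies below
  \<open>\<pi>(a\<^sub>j)\<close> for every other atom \<open>a\<^sub>j\<close>; as there are at least two of these, \<open>\<alpha>(1) = 0\<close>. Hence a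
  bijective sum has a bijective summand.\<close>

section \<open>Bijective endomorphisms of a finite join-semilattice\<close>

text \<open>Applying \<open>\<pi>\<close> to the join of two preimages gives the join of the
  original elements, and injectivity cancels \<open>\<pi>\<close>. The inverse is cut down to
  \<open>L\<close> because members of \<open>join_endos\<close> are extensional.\<close>

lemma inv_into_join_endos:
  assumes "bot \<in> L" and sup: "\<And>x y. x \<in> L \<Longrightarrow> y \<in> L \<Longrightarrow> sup x y \<in> L"
    and \<pi>: "\<pi> \<in> join_endos L" and bij: "bij_betw \<pi> L L"
  shows "restrict (inv_into L \<pi>) L \<in> join_endos L"
proof -
  let ?g = "inv_into L \<pi>"
  have g: "?g x \<in> L" "\<pi> (?g x) = x" if "x \<in> L" for x
    using bij_betw_imp_surj_on[OF bij] that by (simp_all add: inv_into_into f_inv_into_f)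
  have gl: "?g (\<pi> x) = x" if "x \<in> L" for x
    using bij that by (rule bij_betw_inv_into_left)
  have "?g (sup x y) = sup (?g x) (?g y)" if "x \<in> L" "y \<in> L" for x y
  proof -
    have "\<pi> (sup (?g x) (?g y)) = sup x y"
      using \<pi> g that by (simp add: join_endos_def)
    then show ?thesis
      using gl[OF sup[OF g(1)[OF that(1)] g(1)[OF that(2)]]] by simp
  qed
  moreover have "?g bot = bot"
    using gl[OF \<open>bot \<in> L\<close>] \<pi> by (simp add: join_endos_def)
  ultimately show ?thesis
    using assms(1) sup g by (simp add: join_endos_def)
qed

text \<open>Injectivity of the composite passes to the inner map, and an injective self-map of a
  finite set is bijective; cancelling it leaves the outer map bijective.\<close>

lemma bij_betw_comp_finite:
  assumes "finite L" and f: "f \<in> L \<rightarrow> L" and g: "g \<in> L \<rightarrow> L" and bij: "bij_betw (g \<circ> f) L L"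
  shows "bij_betw f L L" "bij_betw g L L"
proof -
  have "inj_on f L"
    using bij by (auto simp: bij_betw_def intro: inj_on_imageI2)
  then show f_bij: "bij_betw f L L"
    using assms(1) f by (simp add: bij_betw_def endo_inj_surj funcset_image)
  show "bij_betw g L L"
    using bij bij_betw_comp_iff[OF f_bij] by blast
qed

text \<open>Only closure under addition depends on the particular lattice, so it enters as the
  hypothesis \<open>sum\<close>. The element \<open>x0\<close> excludes the one-element lattice,
  whose only endomorphism is bijective, so that \<open>M\<close> would be empty.\<close>

lemma maximal_semiring_ideal_nonbijective:
  fixes L :: "'a::bounded_semilattice_sup_bot set"
  defines "M \<equiv> {\<alpha> \<in> join_endos L. \<not> bij_betw \<alpha> L L}"
  assumes fin: "finite L" and bot: "bot \<in> L"
    and sup: "\<And>x y. x \<in> L \<Longrightarrow> y \<in> L \<Longrightarrow> sup x y \<in> L"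
    and nontrivial: "x0 \<in> L" "x0 \<noteq> bot"
    and sum: "\<And>\<alpha> \<beta>. \<alpha> \<in> M \<Longrightarrow> \<beta> \<in> M \<Longrightarrow> \<not> bij_betw (\<lambda>x\<in>L. sup (\<alpha> x) (\<beta> x)) L L"
  shows "maximal_semiring_ideal M (endo_semiring L)"
proof -
  let ?R = "endo_semiring L"
  interpret bare_semiring ?R
    using bot sup by (rule bare_semiring_endo_semiring)
  have carrier: "carrier ?R = join_endos L"
    and plus: "\<alpha> \<oplus>\<^sub>s\<^bsub>?R\<^esub> \<beta> = (\<lambda>x\<in>L. sup (\<alpha> x) (\<beta> x))"
    and times: "\<alpha> \<otimes>\<^sub>s\<^bsub>?R\<^esub> \<beta> = (\<lambda>x\<in>L. \<beta> (\<alpha> x))" for \<alpha> \<beta>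
    by (simp_all add: endo_semiring_def)
  have maps: "\<alpha> \<in> L \<rightarrow> L" if "\<alpha> \<in> join_endos L" for \<alpha>
    using that by (auto simp: join_endos_def)
  have factors: "bij_betw \<alpha> L L \<and> bij_betw \<beta> L L"
    if "\<alpha> \<in> join_endos L" "\<beta> \<in> join_endos L" "bij_betw (\<alpha> \<otimes>\<^sub>s\<^bsub>?R\<^esub> \<beta>) L L" for \<alpha> \<beta>
  proof -
    \<comment> \<open>The semiring product is restricted to \<open>L\<close> and agrees with the
      plain composite only there.\<close>
    have "bij_betw (\<beta> \<circ> \<alpha>) L L"
      using that(3) by (subst bij_betw_cong[where g = "\<alpha> \<otimes>\<^sub>s\<^bsub>?R\<^esub> \<beta>"]) (simp_all add: times)
    then show ?thesis
      using bij_betw_comp_finite[OF fin maps[OF that(1)] maps[OF that(2)]] by blast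
  qed
  have id: "restrict (\<lambda>x. x) L \<in> join_endos L"
    using bot sup by (simp add: join_endos_def)
  have id_bij: "bij_betw (restrict (\<lambda>x. x) L) L L"
    by (simp add: bij_betw_def inj_on_def)
  have zero: "(\<lambda>x\<in>L. bot) \<in> M"
  proof -
    have "\<not> inj_on (\<lambda>x\<in>L. bot::'a) L"
      using nontrivial bot by (auto simp: inj_on_def)
    then show ?thesis
      using bot sup by (simp add: M_def join_endos_def bij_betw_def)
  qed
  show ?thesis
  proof
    show "M \<subseteq> carrier ?R"
      by (auto simp: M_def carrier)
    show "M \<noteq> {}"
      using zero by blast
    show "\<alpha> \<oplus>\<^sub>s\<^bsub>?R\<^esub> \<beta> \<in> M" if "\<alpha> \<in> M" "\<beta> \<in> M" for \<alpha> \<beta>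
      using sum[OF that] splus_closed[of \<alpha> \<beta>] that by (simp add: M_def carrier plus)
    show "\<rho> \<otimes>\<^sub>s\<^bsub>?R\<^esub> \<alpha> \<in> M" if "\<rho> \<in> carrier ?R" "\<alpha> \<in> M" for \<rho> \<alpha>
      using that stimes_closed[of \<rho> \<alpha>] factors[of \<rho> \<alpha>] by (auto simp: M_def carrier)
    show "\<alpha> \<otimes>\<^sub>s\<^bsub>?R\<^esub> \<rho> \<in> M" if "\<alpha> \<in> M" "\<rho> \<in> carrier ?R" for \<rho> \<alpha>
      using that stimes_closed[of \<alpha> \<rho>] factors[of \<alpha> \<rho>] by (auto simp: M_def carrier)
    show "M \<noteq> carrier ?R"
    proof -
      have "restrict (\<lambda>x. x) L \<notin> M"
        using id_bij by (simp add: M_def)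
      then show ?thesis
        using id carrier by blast
    qed
    show "\<nexists>J. semiring_ideal J ?R \<and> M \<subset> J \<and> J \<subset> carrier ?R"
    proof (rule notI, elim exE conjE)
      fix J assume "semiring_ideal J ?R" and J: "M \<subset> J" "J \<subset> carrier ?R"
      interpret semiring_ideal J ?R by fact
      obtain \<pi> where "\<pi> \<in> J" and \<pi>: "\<pi> \<in> join_endos L" "bij_betw \<pi> L L"
        using J by (auto simp: M_def carrier)
      let ?g = "restrict (inv_into L \<pi>) L"
      have g: "?g \<in> join_endos L"
        using bot sup \<pi> by (rule inv_into_join_endos)
      \<comment> \<open>Since \<open>\<pi>\<close> is invertible, every \<open>\<rho>\<close> is a
        left multiple of it and so lies in \<open>J\<close>.\<close>
      have "\<rho> \<in> J" if \<rho>: "\<rho> \<in> carrier ?R" for \<rho>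
      proof -
        have "(\<rho> \<otimes>\<^sub>s\<^bsub>?R\<^esub> ?g) \<otimes>\<^sub>s\<^bsub>?R\<^esub> \<pi> = \<rho>"
        proof
          fix x
          show "((\<rho> \<otimes>\<^sub>s\<^bsub>?R\<^esub> ?g) \<otimes>\<^sub>s\<^bsub>?R\<^esub> \<pi>) x = \<rho> x"
          proof (cases "x \<in> L")
            case True
            then have "\<rho> x \<in> L"
              using maps \<rho> carrier by blast
            then show ?thesis
              using True by (simp add: times bij_betw_inv_into_right[OF \<pi>(2)])
          next
            \<comment> \<open>Off \<open>L\<close> both sides are \<open>undefined\<close>, by
              extensionality.\<close>
            case False
            have "\<rho> \<in> L \<rightarrow>\<^sub>E L"
              using \<rho> by (simp add: carrier join_endos_def)
            then have "\<rho> x = undefined"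
              using False by (rule PiE_arb)
            then show ?thesis
              using False by (simp add: times)
          qed
        qed
        moreover have "\<rho> \<otimes>\<^sub>s\<^bsub>?R\<^esub> ?g \<in> carrier ?R"
          using \<rho> g by (intro stimes_closed) (simp_all add: carrier)
        ultimately show ?thesis
          using ideal_stimes_left \<open>\<pi> \<in> J\<close> by metis
      qed
      then show False
        using J by blast
    qed
  qed
qed

section \<open>Endomorphisms of the lattice \<open>diamond_lattice n\<close>\<close>

lemma bot_in_diamond_lattice: "bot \<in> diamond_lattice n"
  and top_in_diamond_lattice: "top \<in> diamond_lattice n"
  and finite_diamond_lattice: "finite (diamond_lattice n)"
  by (simp_all add: diamond_lattice_def diamond_atoms_def)

lemma diamond_lattice_minus_atoms: "diamond_lattice n - diamond_atoms n = {bot, top}"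
  by (auto simp: diamond_lattice_def diamond_atoms_def bot_diamond_def top_diamond_def)

lemma join_endos_mono:
  assumes "\<alpha> \<in> join_endos L" "x \<in> L" "y \<in> L" "x \<le> y"
  shows "\<alpha> x \<le> \<alpha> y"
proof -
  have "\<alpha> (sup x y) = sup (\<alpha> x) (\<alpha> y)"
    using assms(1-3) by (simp add: join_endos_def)
  then show ?thesis
    using assms(4) by (simp add: sup_absorb2 le_iff_sup)
qed

text \<open>A preimage of \<open>top\<close> lies below \<open>top\<close>, so monotonicity forces
  the value at \<open>top\<close>.\<close>

lemma join_endos_bij_top:
  fixes \<alpha> :: "'a::bounded_lattice \<Rightarrow> 'a"
  assumes \<alpha>: "\<alpha> \<in> join_endos L" and bij: "bij_betw \<alpha> L L" and top: "top \<in> L"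
  shows "\<alpha> top = top"
proof -
  obtain y where "y \<in> L" "\<alpha> y = top"
    using bij top by (metis bij_betw_imp_surj_on imageE)
  then show ?thesis
    using join_endos_mono[OF \<alpha> _ top, of y] by (simp add: top_le)
qed

text \<open>This puts the permutations into the form that the general criterion needs. The lattice
  splits into the atoms and \<open>{bot, top}\<close>; the second part is mapped bijectively to
  itself in either direction of the proof, so bijectivity on the lattice and on the atoms are
  equivalent.\<close>

lemma diamond_perms_eq:
  "diamond_perms n = {\<alpha> \<in> join_endos (diamond_lattice n).
     bij_betw \<alpha> (diamond_lattice n) (diamond_lattice n)}"
proof -
  let ?L = "diamond_lattice n" and ?A = "diamond_atoms n"
  have L: "?L = ?A \<union> {bot, top}" "?A \<inter> {bot, top} = {}"
    using diamond_lattice_minus_atoms[of n] by (auto simp: diamond_lattice_def)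
  have "\<alpha> top = top \<and> bij_betw \<alpha> ?A ?A \<longleftrightarrow> bij_betw \<alpha> ?L ?L" if \<alpha>: "\<alpha> \<in> join_endos ?L" for \<alpha>
  proof -
    have bot: "\<alpha> bot = bot"
      using \<alpha> by (simp add: join_endos_def)
    have ends: "bij_betw \<alpha> {bot, top} {bot, top}" if "\<alpha> top = top"
      using that bot by (auto simp: bij_betw_def inj_on_def)
    show ?thesis
    proof
      assume "\<alpha> top = top \<and> bij_betw \<alpha> ?A ?A"
      then show "bij_betw \<alpha> ?L ?L"
        using bij_betw_combine[of \<alpha> ?A ?A "{bot, top}" "{bot, top}"] ends L by simp
    next
      assume bij: "bij_betw \<alpha> ?L ?L"
      have top: "\<alpha> top = top"
        using \<alpha> bij top_in_diamond_lattice by (rule join_endos_bij_top)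
      have "bij_betw \<alpha> ?A ?A"
        using bij ends[OF top] L bij_betw_partition[of \<alpha> ?A "{bot, top}" ?A "{bot, top}"] by simp
      with top show "\<alpha> top = top \<and> bij_betw \<alpha> ?A ?A" ..
    qed
  qed
  then show ?thesis
    by (auto simp: diamond_perms_def endo_semiring_def)
qed

lemma sup_inf_diamond_atoms:
  assumes "a \<in> diamond_atoms n" "b \<in> diamond_atoms n" "a \<noteq> b"
  shows "sup a b = top" "inf a b = bot"
  using assms
  by (auto simp: diamond_atoms_def sup_diamond_def inf_diamond_def less_eq_diamond_def
      top_diamond_def bot_diamond_def)

lemma le_diamond_atom:
  assumes "a \<in> diamond_atoms n" "x \<le> a"
  shows "x = bot \<or> x = a"
  using assms by (auto simp: diamond_atoms_def less_eq_diamond_def bot_diamond_def)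

text \<open>Each \<open>\<pi> a\<close> is an atom, so \<open>\<alpha> a\<close> is either
  \<open>\<pi> a\<close> or \<open>bot\<close>. For n = 4 the claim fails: killing one atom and
  sending both the other atom b and \<open>top\<close> to \<open>\<pi> b\<close> gives a map that is
  neither \<open>\<pi>\<close> nor zero.\<close>

lemma diamond_endo_below_perm:
  assumes n: "n > 4" and \<alpha>: "\<alpha> \<in> join_endos (diamond_lattice n)" and \<pi>: "\<pi> \<in> diamond_perms n"
    and le: "\<And>x. x \<in> diamond_lattice n \<Longrightarrow> \<alpha> x \<le> \<pi> x"
  shows "\<alpha> = \<pi> \<or> (\<forall>x \<in> diamond_lattice n. \<alpha> x = bot)"
proof -
  let ?L = "diamond_lattice n" and ?A = "diamond_atoms n"
  have AL: "a \<in> ?L" if "a \<in> ?A" for a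
    using that by (simp add: diamond_lattice_def)
  have \<pi>_endo: "\<pi> \<in> join_endos ?L" and bij: "bij_betw \<pi> ?A ?A" and \<pi>_top: "\<pi> top = top"
    using \<pi> by (auto simp: diamond_perms_def endo_semiring_def)
  have \<pi>_atom: "\<pi> a \<in> ?A" if "a \<in> ?A" for a
    using bij that by (rule bij_betw_apply)
  have join: "\<alpha> top = sup (\<alpha> a) (\<alpha> b)" if "a \<in> ?A" "b \<in> ?A" "a \<noteq> b" for a b
  proof -
    have "\<alpha> (sup a b) = sup (\<alpha> a) (\<alpha> b)"
      using \<alpha> AL[OF that(1)] AL[OF that(2)] by (simp add: join_endos_def)
    then show ?thesis
      by (simp add: sup_inf_diamond_atoms(1)[OF that])
  qed
  have card: "card ?A = n - 2"
    by (simp add: diamond_atoms_def card_image inj_on_def)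
  \<comment> \<open>There are n - 2 > 2 atoms, so two of them never exhaust the supply.\<close>
  have avoid: "\<exists>b \<in> ?A. b \<notin> F" if "finite F" "card F \<le> 2" for F
  proof (rule ccontr)
    assume "\<not> (\<exists>b \<in> ?A. b \<notin> F)"
    then have "card ?A \<le> card F"
      using that(1) by (intro card_mono) auto
    then show False
      using that(2) n card by simp
  qed
  consider "\<forall>a \<in> ?A. \<alpha> a = \<pi> a" | c where "c \<in> ?A" "\<alpha> c = bot"
    using le_diamond_atom[OF \<pi>_atom le[OF AL]] by blast
  then show ?thesis
  proof cases
    case 1
    obtain a where a: "a \<in> ?A"
      using avoid[of "{}"] by auto
    obtain b where b: "b \<in> ?A" "a \<noteq> b"
      using avoid[of "{a}"] by auto
    have "\<pi> a \<noteq> \<pi> b"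
      using bij a b by (auto simp: bij_betw_def inj_on_def)
    \<comment> \<open>\<open>top\<close> is the join of two distinct atoms a and b, whose images
      \<open>\<pi> a\<close> and \<open>\<pi> b\<close> are again distinct atoms.\<close>
    then have "\<alpha> top = top"
      using join[OF a b] 1 a b sup_inf_diamond_atoms(1)[OF \<pi>_atom \<pi>_atom] by metis
    then have "\<alpha> x = \<pi> x" if "x \<in> ?L" for x
      using 1 that \<alpha> \<pi>_endo \<pi>_top by (auto simp: diamond_lattice_def join_endos_def)
    moreover have "\<alpha> \<in> ?L \<rightarrow>\<^sub>E ?L" "\<pi> \<in> ?L \<rightarrow>\<^sub>E ?L"
      using \<alpha> \<pi>_endo by (simp_all add: join_endos_def)
    ultimately have "\<alpha> = \<pi>"
      using PiE_ext[of \<alpha> ?L "\<lambda>_. ?L" \<pi>] by blast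
    then show ?thesis ..
  next
    case (2 c)
    obtain a where a: "a \<in> ?A" "a \<noteq> c"
      using avoid[of "{c}"] by auto
    obtain b where b: "b \<in> ?A" "b \<noteq> a" "b \<noteq> c"
      using avoid[of "{a, c}"] a(2) by auto
    \<comment> \<open>As \<open>top\<close> is the join of d and the killed atom c,
      \<open>\<alpha> top\<close> equals \<open>\<alpha> d\<close>. Taking d to be a and then b puts
      it below two distinct atoms.\<close>
    have "\<alpha> top \<le> \<pi> d" if "d \<in> ?A" "d \<noteq> c" for d
      using join[OF that(1) \<open>c \<in> ?A\<close> that(2)] 2 le[OF AL[OF that(1)]] by simp
    moreover have "inf (\<pi> a) (\<pi> b) = bot"
      using bij a b by (intro sup_inf_diamond_atoms(2)[OF \<pi>_atom \<pi>_atom])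
        (auto simp: bij_betw_def inj_on_def)
    ultimately have "\<alpha> top = bot"
      using a b by (metis le_inf_iff bot.extremum_unique)
    then show ?thesis
      using join_endos_mono[OF \<alpha> _ top_in_diamond_lattice]
      by (metis bot.extremum_unique top_greatest)
  qed
qed

theorem proposition4p4:
  fixes n :: nat
  assumes "n > 4"
  shows "maximal_semiring_ideal (diamond_MAX n) (diamond_endos n)"
proof -
  let ?L = "diamond_lattice n"
  have MAX: "diamond_MAX n = {\<alpha> \<in> join_endos ?L. \<not> bij_betw \<alpha> ?L ?L}"
    by (auto simp: diamond_MAX_def diamond_perms_eq endo_semiring_def)
  have bare: "bare_semiring (diamond_endos n)"
    using bot_in_diamond_lattice sup_closed_diamond_lattice by (rule bare_semiring_endo_semiring)
  have sum: "\<not> bij_betw (\<lambda>x\<in>?L. sup (\<alpha> x) (\<beta> x)) ?L ?L"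
    if \<alpha>: "\<alpha> \<in> join_endos ?L" "\<not> bij_betw \<alpha> ?L ?L" and \<beta>: "\<beta> \<in> join_endos ?L" "\<not> bij_betw \<beta> ?L ?L"
    for \<alpha> \<beta>
  proof
    let ?\<pi> = "\<lambda>x\<in>?L. sup (\<alpha> x) (\<beta> x)"
    assume bij: "bij_betw ?\<pi> ?L ?L"
    have "?\<pi> \<in> join_endos ?L"
      using bare_semiring.splus_closed[OF bare, of \<alpha> \<beta>] \<alpha> \<beta> by (simp add: endo_semiring_def)
    then have \<pi>: "?\<pi> \<in> diamond_perms n"
      using bij by (simp add: diamond_perms_eq)
    \<comment> \<open>A nonbijective map differs from the bijective sum \<open>?\<pi>\<close>, so
      one lying below it must vanish. Both summands lie below their sum; hence the sum would vanish
      too, although it fixes \<open>top\<close>.\<close>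
    have zero: "\<forall>x \<in> ?L. \<gamma> x = bot"
      if "\<gamma> \<in> join_endos ?L" "\<not> bij_betw \<gamma> ?L ?L" "\<And>x. x \<in> ?L \<Longrightarrow> \<gamma> x \<le> ?\<pi> x" for \<gamma>
      using diamond_endo_below_perm[OF assms that(1) \<pi> that(3)] that(2) bij by metis
    have "\<forall>x \<in> ?L. \<alpha> x = bot"
      by (rule zero[OF \<alpha>]) simp
    moreover have "\<forall>x \<in> ?L. \<beta> x = bot"
      by (rule zero[OF \<beta>]) simp
    ultimately have "?\<pi> top = bot"
      by (simp add: top_in_diamond_lattice)
    then show False
      using \<pi> by (simp add: diamond_perms_def bot_diamond_def top_diamond_def)
  qed
  have ne: "(top :: diamond) \<noteq> bot"
    by (simp add: bot_diamond_def top_diamond_def)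
  show ?thesis
    unfolding MAX
    using finite_diamond_lattice bot_in_diamond_lattice sup_closed_diamond_lattice
      top_in_diamond_lattice ne
  proof (rule maximal_semiring_ideal_nonbijective)
    fix \<alpha> \<beta>
    assume "\<alpha> \<in> {\<alpha> \<in> join_endos ?L. \<not> bij_betw \<alpha> ?L ?L}" "\<beta> \<in> {\<alpha> \<in> join_endos ?L. \<not> bij_betw \<alpha> ?L ?L}"
    then show "\<not> bij_betw (\<lambda>x\<in>?L. sup (\<alpha> x) (\<beta> x)) ?L ?L"
      using sum by blast
  qed
qed

end
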